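(* Thompson's group $F$ is not graph automatic with respect to the normal form $L_\infty\subseteq\{a,b,\#\}^*$ and alphabet $\{a,b,\#\}$ (with generating set $X=\{x_0^{\pm1},x_1^{\pm1}\}$). That is, it is not the case that $L_\infty$ is regular and, for every $x\in X$, the language $L_x=\{\otimes(u,v)\mid u,v\in L_\infty,\ \overline v=_F\overline u x\}$ is regular.
   Context: Thompson's group $F$ is the group with presentation $\langle x_0,x_1,x_2,\dots \mid x_jx_i=x_ix_{j+1}\text{ whenever } i<j\rangle$; it is generated by $x_0,x_1$. The language $L_\infty\subseteq\{a,b,\#\}^*$ consists of the empty string together with all strings of the form $a^{r_0}b^{s_0}\#a^{r_1}b^{s_1}\#\cdots\#a^{r_M}b^{s_M}$ with $M\ge 0$, where all $r_i,s_i\ge0$ are integers, exactly one of $r_M,s_M$ is nonzero, and for all $0\le i<M$, $r_is_i>0$ implies $r_{i+1}+s_{i+1}>0$. The string $u=a^{r_0}b^{s_0}\#\cdots\#a^{r_M}b^{s_M}$ represents the element $\overline u=x_0^{r_0}x_1^{r_1}\cdots x_M^{r_M}x_M^{-s_M}\cdots x_1^{-s_1}x_0^{-s_0}$ of $F$, and the empty string represents the identity. Convolution: let $\Lambda=\{a,b,\#\}$, $\diamond\notin\Lambda$ a symbol, and $\Lambda_\diamond=\Lambda\cup\{\diamond\}$. For $u,v\in\Lambda^*$, $\otimes(u,v)$ is the string of length $\max(|u|,|v|)$ over the alphabet $(\Lambda_\diamond)^2$ whose $i$th letter is $\binom{\lambda_1}{\lambda_2}$, where $\lambda_1$ is the $i$th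 letter of $u$ if $i\le|u|$ and $\diamond$ otherwise, and $\lambda_2$ is the $i$th letter of $v$ if $i\le|v|$ and $\diamond$ otherwise. A group $G$ with symmetric generating set $X$ is graph automatic with respect to a normal form $L\subseteq\Lambda^*$ (a language in bijection $u\mapsto\overline u$ with $G$) if $L$ is regular and for each $x\in X$ the language $\{\otimes(u,v)\mid u,v\in L,\ \overline v=_G\overline u x\}$ is regular. *)

theory Defs
  imports "HOL-Algebra.Generated_Groups"
begin

section \<open>Groups given by a presentation\<close>

text \<open>
  Words over the generators are lists of pairs: \<open>(g, True)\<close> stands for the generator \<open>g\<close> and
  \<open>(g, False)\<close> for its formal inverse.  A set \<open>R\<close> of pairs of words is read as the set of
  defining relations \<open>u = v\<close>.  The group is the quotient of the set of words by the least
  congruence that contains \<open>R\<close> and the free cancellations.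
\<close>

type_synonym 'g gword = "('g \<times> bool) list"

inductive_set presentation_cong :: "('g gword \<times> 'g gword) set \<Rightarrow> ('g gword \<times> 'g gword) set"
  for R where
  pc_relator: "(u, v) \<in> R \<Longrightarrow> (u, v) \<in> presentation_cong R"
| pc_cancel: "([(g, e), (g, \<not> e)], []) \<in> presentation_cong R"
| pc_context: "(u, v) \<in> presentation_cong R \<Longrightarrow> (p @ u @ q, p @ v @ q) \<in> presentation_cong R"
| pc_refl: "(u, u) \<in> presentation_cong R"
| pc_sym: "(u, v) \<in> presentation_cong R \<Longrightarrow> (v, u) \<in> presentation_cong R"
| pc_trans: "(u, v) \<in> presentation_cong R \<Longrightarrow> (v, w) \<in> presentation_cong R \<Longrightarrow>
    (u, w) \<in> presentation_cong R"

definition presented_group :: "('g gword \<times> 'g gword) set \<Rightarrow> 'g gword set monoid" where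
  "presented_group R =
     \<lparr>carrier = UNIV // presentation_cong R,
      monoid.mult = (\<lambda>A B. \<Union>u\<in>A. \<Union>v\<in>B. presentation_cong R `` {u @ v}),
      one = presentation_cong R `` {[]}\<rparr>"

lemma equiv_presentation_cong: "equiv UNIV (presentation_cong R)"
  by (rule equivI)
     (auto simp: refl_on_def sym_def trans_def intro: pc_refl pc_sym pc_trans)

lemma pc_append:
  assumes "(u, u') \<in> presentation_cong R" "(v, v') \<in> presentation_cong R"
  shows "(u @ v, u' @ v') \<in> presentation_cong R"
  using pc_context[OF assms(1), of "[]" v] pc_context[OF assms(2), of u' "[]"]
  by (auto intro: pc_trans)

lemma presented_group_mult:
  "presentation_cong R `` {u} \<otimes>\<^bsub>presented_group R\<^esub> presentation_cong R `` {v}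
     = presentation_cong R `` {u @ v}"
proof -
  have "(\<Union>u'\<in>presentation_cong R `` {u}. \<Union>v'\<in>presentation_cong R `` {v}.
           presentation_cong R `` {u' @ v'}) = presentation_cong R `` {u @ v}"
  proof (rule UN_equiv_class2[OF equiv_presentation_cong equiv_presentation_cong])
    show "(\<lambda>u v. presentation_cong R `` {u @ v}) respects2 presentation_cong R"
      by (rule congruent2I')
         (auto intro!: equiv_class_eq[OF equiv_presentation_cong] pc_append)
  qed auto
  then show ?thesis
    by (simp only: presented_group_def monoid.simps)
qed

lemma word_inverse_cong:
  "(rev (map (\<lambda>(g, e). (g, \<not> e)) w) @ w, []) \<in> presentation_cong R"
proof (induction w)
  case Nil
  show ?case by (simp add: pc_refl)
next
  case (Cons a w)
  obtain g e where a: "a = (g, e)" by (cases a)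
  have "(rev (map (\<lambda>(g, e). (g, \<not> e)) w) @ [(g, \<not> e), (g, \<not> \<not> e)] @ w,
         rev (map (\<lambda>(g, e). (g, \<not> e)) w) @ [] @ w) \<in> presentation_cong R"
    by (rule pc_context[OF pc_cancel])
  with Cons.IH show ?case by (auto simp: a intro: pc_trans)
qed

lemma group_presented_group: "group (presented_group R)"
proof (rule groupI)
  let ?G = "presented_group R"
  have carr: "\<exists>u. x = presentation_cong R `` {u}" if "x \<in> carrier ?G" for x
    using that by (auto simp: presented_group_def quotient_def)
  have one: "\<one>\<^bsub>?G\<^esub> = presentation_cong R `` {[]}"
    by (simp add: presented_group_def)
  have in_carr: "presentation_cong R `` {u} \<in> carrier ?G" for u
    by (simp add: presented_group_def quotientI)
  show "\<one>\<^bsub>?G\<^esub> \<in> carrier ?G"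
    by (simp add: one in_carr)
  show "x \<otimes>\<^bsub>?G\<^esub> y \<in> carrier ?G" if "x \<in> carrier ?G" "y \<in> carrier ?G" for x y
    using carr[OF that(1)] carr[OF that(2)] by (auto simp: presented_group_mult in_carr)
  show "x \<otimes>\<^bsub>?G\<^esub> y \<otimes>\<^bsub>?G\<^esub> z = x \<otimes>\<^bsub>?G\<^esub> (y \<otimes>\<^bsub>?G\<^esub> z)"
    if "x \<in> carrier ?G" "y \<in> carrier ?G" "z \<in> carrier ?G" for x y z
    using carr[OF that(1)] carr[OF that(2)] carr[OF that(3)]
    by (auto simp: presented_group_mult)
  show "\<one>\<^bsub>?G\<^esub> \<otimes>\<^bsub>?G\<^esub> x = x" if "x \<in> carrier ?G" for x
    using carr[OF that] by (auto simp: one presented_group_mult)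
  show "\<exists>y\<in>carrier ?G. y \<otimes>\<^bsub>?G\<^esub> x = \<one>\<^bsub>?G\<^esub>" if "x \<in> carrier ?G" for x
  proof -
    from carr[OF that] obtain u where u: "x = presentation_cong R `` {u}" by blast
    show ?thesis
      by (rule bexI[OF _ in_carr[of "rev (map (\<lambda>(g, e). (g, \<not> e)) u)"]])
         (simp add: u one presented_group_mult
            equiv_class_eq[OF equiv_presentation_cong word_inverse_cong])
  qed
qed


section \<open>Thompson's group F\<close>

definition thompson_relations :: "(nat gword \<times> nat gword) set" where
  "thompson_relations =
     {([(j, True), (i, True)], [(i, True), (j + 1, True)]) | i j. i < j}"

definition thompson_F :: "nat gword set monoid" where
  "thompson_F = presented_group thompson_relations"

definition thompson_x :: "nat \<Rightarrow> nat gword set" where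
  "thompson_x i = presentation_cong thompson_relations `` {[(i, True)]}"

definition thompson_gens :: "nat gword set set" where
  "thompson_gens =
     {thompson_x 0, inv\<^bsub>thompson_F\<^esub> (thompson_x 0), thompson_x 1, inv\<^bsub>thompson_F\<^esub> (thompson_x 1)}"

lemma group_thompson_F: "group thompson_F"
  by (simp add: thompson_F_def group_presented_group)

lemma thompson_x_closed: "thompson_x i \<in> carrier thompson_F"
  by (simp add: thompson_x_def thompson_F_def presented_group_def quotientI)

lemma thompson_x_relation:
  assumes "i < j"
  shows "thompson_x j \<otimes>\<^bsub>thompson_F\<^esub> thompson_x i
       = thompson_x i \<otimes>\<^bsub>thompson_F\<^esub> thompson_x (j + 1)"
proof -
  have "([(j, True), (i, True)], [(i, True), (j + 1, True)]) \<in> presentation_cong thompson_relations"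
    by (rule pc_relator) (use assms in \<open>auto simp: thompson_relations_def\<close>)
  from equiv_class_eq[OF equiv_presentation_cong this] show ?thesis
    by (simp add: thompson_x_def thompson_F_def presented_group_mult)
qed

lemma generate_thompson_gens: "generate thompson_F thompson_gens = carrier thompson_F"
proof
  interpret F: group thompson_F by (rule group_thompson_F)
  have gens: "thompson_gens \<subseteq> carrier thompson_F"
    by (auto simp: thompson_gens_def thompson_x_closed)
  show "generate thompson_F thompson_gens \<subseteq> carrier thompson_F"
    by (rule F.generate_incl[OF gens])
  have sub: "subgroup (generate thompson_F thompson_gens) thompson_F"
    by (rule F.generate_is_subgroup[OF gens])
  have base: "thompson_x i \<in> generate thompson_F thompson_gens" if "i \<le> 1" for i
  proof -
    have "i = 0 \<or> i = 1" using that by arith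
    then show ?thesis
      by (auto simp: thompson_gens_def intro: generate.incl)
  qed
  have x: "thompson_x i \<in> generate thompson_F thompson_gens" for i
  proof (induction i)
    case 0
    show ?case by (rule base) simp
  next
    case (Suc i)
    show ?case
    proof (cases "i = 0")
      case True
      then show ?thesis by (simp add: base)
    next
      case False
      then have "thompson_x 0 \<otimes>\<^bsub>thompson_F\<^esub> thompson_x (Suc i)
          = thompson_x i \<otimes>\<^bsub>thompson_F\<^esub> thompson_x 0"
        using thompson_x_relation[of 0 i] by simp
      then have "thompson_x (Suc i) =
          inv\<^bsub>thompson_F\<^esub> (thompson_x 0) \<otimes>\<^bsub>thompson_F\<^esub> (thompson_x i \<otimes>\<^bsub>thompson_F\<^esub> thompson_x 0)"
        by (metis F.inv_solve_left F.m_closed thompson_x_closed)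
      then show ?thesis
        using subgroup.m_closed[OF sub] subgroup.m_inv_closed[OF sub] Suc.IH base[of 0]
        by simp
    qed
  qed
  have inv_x: "presentation_cong thompson_relations `` {[(i, False)]} = inv\<^bsub>thompson_F\<^esub> (thompson_x i)"
    for i
  proof (rule F.inv_equality[symmetric])
    have "([(i, False), (i, True)], []) \<in> presentation_cong thompson_relations"
      using pc_cancel[of i False] by simp
    then show "presentation_cong thompson_relations `` {[(i, False)]} \<otimes>\<^bsub>thompson_F\<^esub> thompson_x i
        = \<one>\<^bsub>thompson_F\<^esub>"
      using equiv_class_eq[OF equiv_presentation_cong]
      by (simp add: thompson_x_def thompson_F_def presented_group_mult)
         (simp add: presented_group_def)
  qed (simp_all add: thompson_x_closed, simp add: thompson_F_def presented_group_def quotientI)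
  have letter: "presentation_cong thompson_relations `` {[(i, e)]}
      \<in> generate thompson_F thompson_gens" for i e
    using x[of i] subgroup.m_inv_closed[OF sub x[of i]]
    by (cases e) (simp_all add: inv_x, simp add: thompson_x_def)
  have "presentation_cong thompson_relations `` {w} \<in> generate thompson_F thompson_gens" for w
  proof (induction w)
    case Nil
    have "presentation_cong thompson_relations `` {[]} = \<one>\<^bsub>thompson_F\<^esub>"
      by (simp add: thompson_F_def presented_group_def)
    then show ?case by (simp add: generate.one)
  next
    case (Cons p w)
    obtain i e where p: "p = (i, e)" by (cases p)
    have "presentation_cong thompson_relations `` {p # w}
        = presentation_cong thompson_relations `` {[p]} \<otimes>\<^bsub>thompson_F\<^esub>
          presentation_cong thompson_relations `` {w}"
      by (simp add: thompson_F_def presented_group_mult)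
    then show ?case
      using subgroup.m_closed[OF sub letter Cons.IH] by (simp add: p)
  qed
  then show "carrier thompson_F \<subseteq> generate thompson_F thompson_gens"
    by (auto simp: thompson_F_def presented_group_def quotient_def)
qed


section \<open>Regular languages, convolution, graph automatic groups\<close>

text \<open>
  Acceptance by a complete deterministic finite automaton.  As the state set is finite,
  taking the states to be natural numbers is no restriction.
\<close>

definition regular_language :: "'a::finite list set \<Rightarrow> bool" where
  "regular_language L \<longleftrightarrow>
     (\<exists>(Q :: nat set) (\<delta> :: nat \<Rightarrow> 'a \<Rightarrow> nat) q0 Acc.
        finite Q \<and> q0 \<in> Q \<and> Acc \<subseteq> Q \<and> (\<forall>q\<in>Q. \<forall>c. \<delta> q c \<in> Q) \<and>
        L = {w. foldl \<delta> q0 w \<in> Acc})"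

text \<open>The padding symbol is \<open>None\<close>, so the padded alphabet is \<open>'a option\<close>.\<close>

definition convolution :: "'a list \<Rightarrow> 'a list \<Rightarrow> ('a option \<times> 'a option) list" where
  "convolution u v =
     map (\<lambda>i. (if i < length u then Some (u ! i) else None,
               if i < length v then Some (v ! i) else None))
         [0..<max (length u) (length v)]"

definition mult_language ::
    "('g, 'm) monoid_scheme \<Rightarrow> 'a list set \<Rightarrow> ('a list \<Rightarrow> 'g) \<Rightarrow> 'g \<Rightarrow> ('a option \<times> 'a option) list set"
  where
  "mult_language G L val x =
     {convolution u v | u v. u \<in> L \<and> v \<in> L \<and> val v = val u \<otimes>\<^bsub>G\<^esub> x}"

text \<open>
  That \<open>G\<close> is a group with symmetric generating set \<open>X\<close> and that \<open>val\<close> maps \<open>L\<close> bijectively onto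
  \<open>G\<close> are standing conditions on the data of a normal form, not part of the property.  They are
  kept out of the definition, so that its negation says that regularity itself fails.
\<close>

definition graph_automatic_wrt ::
    "('g, 'm) monoid_scheme \<Rightarrow> 'g set \<Rightarrow> 'a::finite list set \<Rightarrow> ('a list \<Rightarrow> 'g) \<Rightarrow> bool" where
  "graph_automatic_wrt G X L val \<longleftrightarrow>
     regular_language L \<and> (\<forall>x\<in>X. regular_language (mult_language G L val x))"


section \<open>The infinite normal form\<close>

datatype letter = LA | LB | Hash

instance letter :: finite
proof
  have "(UNIV :: letter set) = {LA, LB, Hash}"
    using letter.exhaust by blast
  then show "finite (UNIV :: letter set)"
    by (metis finite.emptyI finite_insert)
qed

text \<open>The string \<open>a^(r 0) b^(s 0) # ... # a^(r M) b^(s M)\<close>.\<close>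

definition block_string :: "nat \<Rightarrow> (nat \<Rightarrow> nat) \<Rightarrow> (nat \<Rightarrow> nat) \<Rightarrow> letter list" where
  "block_string M r s =
     concat (map (\<lambda>i. replicate (r i) LA @ replicate (s i) LB @ [Hash]) [0..<M])
       @ replicate (r M) LA @ replicate (s M) LB"

definition L_infinity :: "letter list set" where
  "L_infinity = {[]} \<union>
     {block_string M r s | M r s.
        (r M \<noteq> 0) \<noteq> (s M \<noteq> 0) \<and>
        (\<forall>i<M. r i * s i > 0 \<longrightarrow> r (i + 1) + s (i + 1) > 0)}"

text \<open>
  The element represented by a string.  The first argument is the index of the current block,
  i.e. the number of \<open>#\<close> read so far; an \<open>a\<close> contributes on the left of what follows and a \<open>b\<close>
  contributes an inverse on the right.  On block strings this gives the product formula of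
  \<open>nf_value_block_string\<close> below.
\<close>

fun nf_value_from :: "nat \<Rightarrow> letter list \<Rightarrow> nat gword set" where
  "nf_value_from i [] = \<one>\<^bsub>thompson_F\<^esub>"
| "nf_value_from i (LA # w) = thompson_x i \<otimes>\<^bsub>thompson_F\<^esub> nf_value_from i w"
| "nf_value_from i (LB # w) = nf_value_from i w \<otimes>\<^bsub>thompson_F\<^esub> inv\<^bsub>thompson_F\<^esub> (thompson_x i)"
| "nf_value_from i (Hash # w) = nf_value_from (i + 1) w"

definition nf_value :: "letter list \<Rightarrow> nat gword set" where
  "nf_value w = nf_value_from 0 w"

lemma nf_value_from_closed: "nf_value_from i w \<in> carrier thompson_F"
proof -
  interpret F: group thompson_F by (rule group_thompson_F)
  show ?thesis
    by (induction i w rule: nf_value_from.induct) (simp_all add: thompson_x_closed)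
qed

lemma nf_value_from_LA:
  "nf_value_from i (replicate n LA @ w)
     = thompson_x i [^]\<^bsub>thompson_F\<^esub> n \<otimes>\<^bsub>thompson_F\<^esub> nf_value_from i w"
proof -
  interpret F: group thompson_F by (rule group_thompson_F)
  show ?thesis
  proof (induction n)
    case 0
    show ?case by (simp add: nf_value_from_closed)
  next
    case (Suc n)
    then show ?case
      using F.nat_pow_Suc2[OF thompson_x_closed, of i n]
      by (simp add: nf_value_from_closed thompson_x_closed flip: F.m_assoc)
  qed
qed

lemma nf_value_from_LB:
  "nf_value_from i (replicate n LB @ w)
     = nf_value_from i w \<otimes>\<^bsub>thompson_F\<^esub> thompson_x i [^]\<^bsub>thompson_F\<^esub> (- int n)"
proof -
  interpret F: group thompson_F by (rule group_thompson_F)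
  have "nf_value_from i (replicate n LB @ w)
     = nf_value_from i w \<otimes>\<^bsub>thompson_F\<^esub> inv\<^bsub>thompson_F\<^esub> (thompson_x i) [^]\<^bsub>thompson_F\<^esub> n"
    by (induction n)
       (simp_all add: nf_value_from_closed thompson_x_closed F.m_assoc)
  then show ?thesis
    by (simp add: F.int_pow_neg_int F.nat_pow_inv thompson_x_closed)
qed

lemma nf_value_block_string:
  "nf_value (block_string M r s) =
     foldr (\<otimes>\<^bsub>thompson_F\<^esub>)
       (map (\<lambda>i. thompson_x i [^]\<^bsub>thompson_F\<^esub> r i) [0..<M + 1] @
        map (\<lambda>i. thompson_x i [^]\<^bsub>thompson_F\<^esub> (- int (s i))) (rev [0..<M + 1]))
       \<one>\<^bsub>thompson_F\<^esub>"
proof -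
  interpret F: group thompson_F by (rule group_thompson_F)
  let ?x = "\<lambda>i. thompson_x i [^]\<^bsub>thompson_F\<^esub> r i"
  let ?y = "\<lambda>i. thompson_x i [^]\<^bsub>thompson_F\<^esub> (- int (s i))"
  let ?prod = "\<lambda>gs. foldr (\<otimes>\<^bsub>thompson_F\<^esub>) gs \<one>\<^bsub>thompson_F\<^esub>"
  let ?blocks = "\<lambda>k. concat (map (\<lambda>i. replicate (r i) LA @ replicate (s i) LB @ [Hash]) [k..<M])
       @ replicate (r M) LA @ replicate (s M) LB"
  have closed: "?prod gs \<in> carrier thompson_F" if "set gs \<subseteq> carrier thompson_F" for gs
    using that by (induction gs) auto
  have snoc: "?prod (gs @ [g]) = ?prod gs \<otimes>\<^bsub>thompson_F\<^esub> g"
    if "set gs \<subseteq> carrier thompson_F" "g \<in> carrier thompson_F" for gs g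
    using that by (induction gs) (auto simp: F.m_assoc closed)
  have "nf_value_from k (?blocks k)
      = ?prod (map ?x [k..<M + 1] @ map ?y (rev [k..<M + 1]))" if "k \<le> M" for k
    using that
  proof (induction k rule: inc_induct)
    case base
    have "nf_value_from M (replicate (s M) LB) = ?y M"
      using nf_value_from_LB[of M "s M" "[]"] by (simp add: thompson_x_closed)
    then show ?case
      by (simp add: nf_value_from_LA thompson_x_closed)
  next
    case (step k)
    let ?gs = "map ?x [Suc k..<M + 1] @ map ?y (rev [Suc k..<M + 1])"
    have gs: "set ?gs \<subseteq> carrier thompson_F"
      by (auto simp: thompson_x_closed)
    have "?blocks k = replicate (r k) LA @ replicate (s k) LB @ Hash # ?blocks (Suc k)"
      using step.hyps by (simp add: upt_conv_Cons)
    then have "nf_value_from k (?blocks k)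
        = ?x k \<otimes>\<^bsub>thompson_F\<^esub> (nf_value_from (Suc k) (?blocks (Suc k)) \<otimes>\<^bsub>thompson_F\<^esub> ?y k)"
      by (simp only: nf_value_from_LA nf_value_from_LB nf_value_from.simps Suc_eq_plus1)
    also have "\<dots> = ?x k \<otimes>\<^bsub>thompson_F\<^esub> ?prod (?gs @ [?y k])"
      by (simp only: step.IH snoc[OF gs] F.int_pow_closed thompson_x_closed)
    also have "\<dots> = ?prod (map ?x [k..<M + 1] @ map ?y (rev [k..<M + 1]))"
    proof -
      have "[k..<M + 1] = k # [Suc k..<M + 1]"
        using step.hyps by (simp add: upt_conv_Cons del: upt_Suc)
      then show ?thesis by (simp del: upt_Suc)
    qed
    finally show ?case .
  qed
  from this[of 0] show ?thesis
    by (simp only: nf_value_def block_string_def)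
qed

end

theory Submission
  imports Defs Complex_Main
begin

text \<open>
  Conjugation by \<open>x\<^sub>0\<close> shifts the generators, so \<open>x\<^sub>0\<^sup>-\<^sup>n x\<^sub>1 = x\<^bsub>n+1\<^esub> x\<^sub>0\<^sup>-\<^sup>n\<close>
  (\<open>thompson_x_conj_power\<close>).  In normal forms, right multiplication by \<open>x\<^sub>1\<close> therefore turns
  \<open>b\<^sup>n\<close> into \<open>b\<^sup>n #\<^bsup>n+1\<^esup> a\<close>: the number of \<open>b\<close>'s has to be repeated as a number of \<open>#\<close>'s in
  the part that comes after the end of the first word.  An automaton for the convolutions
  reaches the same state after \<open>(b, b)\<^sup>i\<close> and \<open>(b, b)\<^sup>j\<close> for some \<open>i < j\<close>
  (\<open>regular_language_prefix_collision\<close>), so it also accepts the convolution of \<open>b\<^sup>i\<close> and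
  \<open>b\<^sup>i #\<^bsup>j+1\<^esup> a\<close>, which gives \<open>x\<^bsub>j+1\<^esub> x\<^sub>0\<^sup>-\<^sup>i = x\<^sub>0\<^sup>-\<^sup>i x\<^sub>1 = x\<^bsub>i+1\<^esub> x\<^sub>0\<^sup>-\<^sup>i\<close>, that is,
  \<open>x\<^bsub>j+1\<^esub> = x\<^bsub>i+1\<^esub>\<close>.

  It remains to see that the generators \<open>x\<^sub>i\<close> are pairwise distinct (\<open>inj_thompson_x\<close>).  As
  every proper quotient of the group is abelian, and all \<open>x\<^sub>i\<close> with \<open>i \<ge> 1\<close> agree in the
  abelianization, only a faithful representation can separate them.  The one used here is the
  classical action by piecewise linear homeomorphisms of the real line.
\<close>

text \<open>
  The homeomorphism fixes everything up to \<open>i\<close>, stretches \<open>[i, i + 1]\<close> onto \<open>[i, i + 2]\<close> and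
  translates the rest by \<open>1\<close>.
\<close>

definition pl_shift :: "nat \<Rightarrow> real \<Rightarrow> real" where
  "pl_shift i t = (if t \<le> i then t else if t \<le> i + 1 then 2 * t - i else t + 1)"

definition pl_unshift :: "nat \<Rightarrow> real \<Rightarrow> real" where
  "pl_unshift i t = (if t \<le> i then t else if t \<le> i + 2 then (t + i) / 2 else t - 1)"

text \<open>
  Words act from the right, letter by letter; with this convention the maps satisfy
  Thompson's relations exactly as they are written in the presentation.
\<close>

definition pl_action :: "nat gword \<Rightarrow> real \<Rightarrow> real" where
  "pl_action w t = foldl (\<lambda>t (i, e). if e then pl_shift i t else pl_unshift i t) t w"

lemma pl_action_simps [simp]:
  "pl_action [] t = t"
  "pl_action ((i, e) # w) t = pl_action w (if e then pl_shift i t else pl_unshift i t)"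
  "pl_action (v @ w) t = pl_action w (pl_action v t)"
  by (simp_all add: pl_action_def)

lemma pl_unshift_pl_shift: "pl_unshift i (pl_shift i t) = t"
  by (auto simp: pl_shift_def pl_unshift_def field_simps)

lemma pl_shift_pl_unshift: "pl_shift i (pl_unshift i t) = t"
  by (auto simp: pl_shift_def pl_unshift_def field_simps)

text \<open>
  On \<open>[i, i + 1]\<close> both sides only apply the map of index \<open>i\<close>, because its image
  \<open>[i, i + 2]\<close> is still fixed by the map of index \<open>j + 1\<close>; from \<open>i + 1\<close> on the map of index
  \<open>i\<close> is the translation by \<open>1\<close>, which moves the breakpoints of index \<open>j\<close> to those of index
  \<open>j + 1\<close>.
\<close>

lemma pl_shift_relation:
  assumes "i < j"
  shows "pl_shift i (pl_shift j t) = pl_shift (j + 1) (pl_shift i t)"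
proof -
  have "real i + 1 \<le> real j" using assms by linarith
  then show ?thesis by (auto simp: pl_shift_def)
qed

lemma pl_action_cong:
  assumes "(u, v) \<in> presentation_cong thompson_relations"
  shows "pl_action u t = pl_action v t"
  using assms
proof (induction arbitrary: t rule: presentation_cong.induct)
  case (pc_relator u v)
  then show ?case
    using pl_shift_relation by (auto simp: thompson_relations_def)
qed (auto simp: pl_unshift_pl_shift pl_shift_pl_unshift)

text \<open>
  The point \<open>i + 1\<close> is moved by the map of index \<open>i\<close> and fixed by all maps of larger index.
\<close>

lemma inj_thompson_x: "inj thompson_x"
proof (rule linorder_injI)
  fix i j :: nat
  assume "i < j"
  show "thompson_x i \<noteq> thompson_x j"
  proof
    assume "thompson_x i = thompson_x j"
    then have "([(i, True)], [(j, True)]) \<in> presentation_cong thompson_relations"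
      by (simp add: thompson_x_def eq_equiv_class[OF _ equiv_presentation_cong])
    then have "pl_shift i (real i + 1) = pl_shift j (real i + 1)"
      using pl_action_cong[of "[(i, True)]" "[(j, True)]"] by simp
    with \<open>i < j\<close> show False by (simp add: pl_shift_def split: if_splits)
  qed
qed

lemma thompson_x_conj_power:
  "thompson_x 0 [^]\<^bsub>thompson_F\<^esub> (- int n) \<otimes>\<^bsub>thompson_F\<^esub> thompson_x 1
     = thompson_x (Suc n) \<otimes>\<^bsub>thompson_F\<^esub> thompson_x 0 [^]\<^bsub>thompson_F\<^esub> (- int n)"
proof -
  interpret F: group thompson_F by (rule group_thompson_F)
  let ?p = "\<lambda>n. thompson_x 0 [^]\<^bsub>thompson_F\<^esub> (n::nat)"
  have closed [simp]: "thompson_x i \<in> carrier thompson_F" for i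
    by (rule thompson_x_closed)
  have pos: "thompson_x 1 \<otimes>\<^bsub>thompson_F\<^esub> ?p n = ?p n \<otimes>\<^bsub>thompson_F\<^esub> thompson_x (Suc n)"
  proof (induction n)
    case (Suc n)
    have "thompson_x 1 \<otimes>\<^bsub>thompson_F\<^esub> ?p (Suc n)
        = (?p n \<otimes>\<^bsub>thompson_F\<^esub> thompson_x (Suc n)) \<otimes>\<^bsub>thompson_F\<^esub> thompson_x 0"
      using Suc.IH by (simp flip: F.m_assoc)
    also have "\<dots> = ?p (Suc n) \<otimes>\<^bsub>thompson_F\<^esub> thompson_x (Suc (Suc n))"
      using thompson_x_relation[of 0 "Suc n"] by (simp add: F.m_assoc)
    finally show ?case .
  qed simp
  have "inv\<^bsub>thompson_F\<^esub> (?p n) \<otimes>\<^bsub>thompson_F\<^esub> thompson_x 1 \<otimes>\<^bsub>thompson_F\<^esub> ?p n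
      = thompson_x (Suc n)"
    using pos by (simp add: F.m_assoc F.inv_solve_left')
  then show ?thesis
    by (simp add: F.int_pow_neg_int F.inv_solve_right)
qed

lemma replicate_LB_in_L_infinity: "replicate n LB \<in> L_infinity"
proof (cases n)
  case (Suc k)
  have "replicate n LB = block_string 0 (\<lambda>_. 0) (\<lambda>_. n)"
    by (simp add: block_string_def)
  moreover have "((0::nat) \<noteq> 0) \<noteq> (n \<noteq> 0)"
    by (simp add: Suc)
  ultimately show ?thesis
    unfolding L_infinity_def by fastforce
qed (simp add: L_infinity_def)

lemma LB_Hash_LA_in_L_infinity:
  "replicate n LB @ replicate (Suc k) Hash @ [LA] \<in> L_infinity"
proof -
  let ?r = "\<lambda>i. if i = Suc k then 1 else 0 :: nat"
  let ?s = "\<lambda>i. if i = 0 then n else 0"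
  have "concat (map (\<lambda>i. replicate (?r i) LA @ replicate (?s i) LB @ [Hash]) [Suc 0..<Suc k])
      = concat (map (\<lambda>i. [Hash]) [Suc 0..<Suc k])"
    by (intro arg_cong[where f = concat] map_cong) auto
  also have "\<dots> = replicate k Hash"
    by (simp add: map_replicate_const del: upt_Suc)
  finally have "replicate n LB @ replicate (Suc k) Hash @ [LA] = block_string (Suc k) ?r ?s"
    by (simp add: block_string_def upt_conv_Cons del: upt_Suc)
  moreover have "(?r (Suc k) \<noteq> 0) \<noteq> (?s (Suc k) \<noteq> 0)"
      "\<forall>i<Suc k. ?r i * ?s i > 0 \<longrightarrow> ?r (i + 1) + ?s (i + 1) > 0"
    by simp_all
  ultimately show ?thesis
    unfolding L_infinity_def by blast
qed

lemma nf_value_replicate_LB: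
  "nf_value (replicate n LB) = thompson_x 0 [^]\<^bsub>thompson_F\<^esub> (- int n)"
proof -
  interpret F: group thompson_F by (rule group_thompson_F)
  show ?thesis
    using nf_value_from_LB[of 0 n "[]"] by (simp add: nf_value_def thompson_x_closed)
qed

lemma nf_value_LB_Hash_LA:
  "nf_value (replicate n LB @ replicate k Hash @ [LA])
     = thompson_x k \<otimes>\<^bsub>thompson_F\<^esub> thompson_x 0 [^]\<^bsub>thompson_F\<^esub> (- int n)"
proof -
  interpret F: group thompson_F by (rule group_thompson_F)
  have "nf_value_from i (replicate k Hash @ [LA]) = thompson_x (i + k)" for i
    by (induction k arbitrary: i) (simp_all add: thompson_x_closed)
  then show ?thesis
    by (simp add: nf_value_def nf_value_from_LB)
qed

lemma convolution_inject:
  assumes "convolution u v = convolution u' v'"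
  shows "u = u'" and "v = v'"
proof -
  have "map fst (convolution u v) = map Some u @ replicate (length v - length u) None" for u v :: "'a list"
    by (rule nth_equalityI) (auto simp: convolution_def nth_append)
  then have "map the (filter (\<lambda>c. c \<noteq> None) (map fst (convolution u v))) = u" for u v :: "'a list"
    by (simp add: filter_map o_def)
  with assms show "u = u'" by metis
  have "map snd (convolution u v) = map Some v @ replicate (length u - length v) None" for u v :: "'a list"
    by (rule nth_equalityI) (auto simp: convolution_def nth_append)
  then have "map the (filter (\<lambda>c. c \<noteq> None) (map snd (convolution u v))) = v" for u v :: "'a list"
    by (simp add: filter_map o_def)
  with assms show "v = v'" by metis
qed

lemma convolution_append_right:
  "convolution u (u @ w) = map (\<lambda>c. (Some c, Some c)) u @ map (\<lambda>c. (None, Some c)) w"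
  by (rule nth_equalityI) (auto simp: convolution_def nth_append)

text \<open>
  The pigeonhole half of the Myhill-Nerode theorem: a finite automaton is in the same state
  after two of infinitely many prefixes.
\<close>

lemma regular_language_prefix_collision:
  fixes p :: "nat \<Rightarrow> 'a::finite list"
  assumes "regular_language L"
  obtains i j where "i < j" "\<And>z. p i @ z \<in> L \<longleftrightarrow> p j @ z \<in> L"
proof -
  from assms obtain Q :: "nat set" and \<delta> q0 Acc
    where fin: "finite Q" and q0: "q0 \<in> Q" and step: "\<forall>q\<in>Q. \<forall>c. \<delta> q c \<in> Q"
      and L: "L = {w. foldl \<delta> q0 w \<in> Acc}"
    unfolding regular_language_def by blast
  have "foldl \<delta> q w \<in> Q" if "q \<in> Q" for q w
    using that step by (induction w arbitrary: q) auto
  then have "range (\<lambda>n. foldl \<delta> q0 (p n)) \<subseteq> Q"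
    using q0 by blast
  then have "\<not> inj (\<lambda>n. foldl \<delta> q0 (p n))"
    using fin finite_subset finite_imageD infinite_UNIV_nat by blast
  then obtain i j where "i < j" "foldl \<delta> q0 (p i) = foldl \<delta> q0 (p j)"
    by (meson linorder_injI)
  then show thesis
    by (intro that[of i j]) (auto simp: L)
qed

theorem lemma3p7:
  shows "\<not> graph_automatic_wrt thompson_F thompson_gens L_infinity nf_value"
proof
  interpret F: group thompson_F by (rule group_thompson_F)
  let ?L = "mult_language thompson_F L_infinity nf_value (thompson_x 1)"
  let ?p = "\<lambda>n. replicate n (Some LB, Some LB)"
  let ?w = "\<lambda>k. replicate (Suc k) Hash @ [LA]"
  let ?z = "\<lambda>k. map (\<lambda>c. (None, Some c)) (?w k)"
  assume "graph_automatic_wrt thompson_F thompson_gens L_infinity nf_value"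
  then have "regular_language ?L"
    by (simp add: graph_automatic_wrt_def thompson_gens_def)
  then obtain i j where "i < j" and same: "\<And>z. ?p i @ z \<in> ?L \<longleftrightarrow> ?p j @ z \<in> ?L"
    using regular_language_prefix_collision[where p = ?p] by blast
  have conv: "convolution (replicate n LB) (replicate n LB @ w)
      = ?p n @ map (\<lambda>c. (None, Some c)) w" for n w
    by (simp add: convolution_append_right)
  have "?p j @ ?z j \<in> ?L"
  proof -
    have "nf_value (replicate j LB @ ?w j) = nf_value (replicate j LB) \<otimes>\<^bsub>thompson_F\<^esub> thompson_x 1"
      by (simp only: nf_value_LB_Hash_LA nf_value_replicate_LB thompson_x_conj_power)
    then show ?thesis
      unfolding mult_language_def
      using conv[of j "?w j"] replicate_LB_in_L_infinity[of j] LB_Hash_LA_in_L_infinity[of j j]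
      by (metis (mono_tags, lifting) mem_Collect_eq)
  qed
  then have "?p i @ ?z j \<in> ?L"
    using same by blast
  then obtain u v where uv: "convolution (replicate i LB) (replicate i LB @ ?w j) = convolution u v"
      "nf_value v = nf_value u \<otimes>\<^bsub>thompson_F\<^esub> thompson_x 1"
    unfolding mult_language_def conv by blast
  have "nf_value (replicate i LB @ ?w j) = nf_value (replicate i LB) \<otimes>\<^bsub>thompson_F\<^esub> thompson_x 1"
    using uv(2) convolution_inject[OF uv(1)] by metis
  then have "thompson_x (Suc j) \<otimes>\<^bsub>thompson_F\<^esub> thompson_x 0 [^]\<^bsub>thompson_F\<^esub> (- int i)
      = thompson_x (Suc i) \<otimes>\<^bsub>thompson_F\<^esub> thompson_x 0 [^]\<^bsub>thompson_F\<^esub> (- int i)"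
    by (simp only: nf_value_LB_Hash_LA nf_value_replicate_LB thompson_x_conj_power)
  then have "thompson_x (Suc j) = thompson_x (Suc i)"
    by (simp only: F.right_cancel F.int_pow_closed thompson_x_closed)
  then have "Suc j = Suc i"
    using inj_thompson_x by (simp only: inj_eq)
  with \<open>i < j\<close> show False by simp
qed

end
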